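(* Let $n\ge 2$, $0<m<n$, let $f:\mathbb{R}^n\to\mathbb{R}^m$ be smooth with Jacobian $J(x)$ of full rank $m$ for every $x\in\mathbb{R}^n$, and let $\delta>0$. With $N(x)$, $T(x)$, $R(x)$, $H(x)$ as in the context, let $\Psi_\delta:\mathbb{R}^n\times\mathbb{R}^n\to\mathbb{R}^n\times\mathbb{R}^n$ be the map $\Psi_\delta(x,v)=(x',v')$, where $v'=R(x+(\delta/2)v)v$ and $x'=x+(\delta/2)v+(\delta/2)v'$. Then: 1. The map $\Psi_\delta$ is volume preserving. 2. The map $\Psi_\delta$ is time-reversible, i.e. for each $x$ and $v$, $\Psi_\delta(x,v)=(x',v')$ if and only if $\Psi_\delta(x',-v')=(x,-v)$. Furthermore, let $K\ge 1$, $x_0,v_0\in\mathbb{R}^n$, and for $k=0,\dots,K-1$ let $$x_{k+1/2}=x_k+(\delta/2)v_k,\qquad v_{k+1}=R(x_{k+1/2})v_k,\qquad x_{k+1}=x_{k+1/2}+(\delta/2)v_{k+1}.$$ Then: 3. For each $k=0,\dots,K-1$, $$T(x_{k+1/2})v_{k+1}=T(x_{k+1/2})v_k,\qquad N(x_{k+1/2})v_{k+1}=-N(x_{k+1/2})v_k,$$ and $v_k+v_{k+1}=2T(x_{k+1/2})v_k$. 4. The vectors $v_0,\dots,v_K$ share the common Euclidean length $\|v_0\|$. 5. The vectors $x_{k+1/2}-x_k$, $k=0,\dots,K-1$, and $x_{k+1}-x_{k+1/2}$, $k=0,\dots,K-1$, share the common Euclidean length $(\delta/2)\|v_0\|$.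 The vectors $x_{k+3/2}-x_{k+1/2}$, $k=0,\dots,K-2$, share the common Euclidean length $\delta\|v_0\|$. 6. If, as $x$ ranges in $\mathbb{R}^n$, $\|H(x)\|$ is upper bounded by $\beta$ and $H$ is $\gamma$-Lipschitz continuous, i.e. $\|H(x)-H(y)\|\le\gamma\|x-y\|$ for all $x,y\in\mathbb{R}^n$, then $$\|f(x_K)-f(x_0)\|\le\frac{\delta^2}{12}\|v_0\|^2\bigl(3\beta+\gamma(K-1)\delta\|v_0\|\bigr).$$ 7. If $H(x)$ is of the form $H(x)[w,w]=\|w\|^2\nu$ for a fixed $\nu\in\mathbb{R}^m$ (for all $x,w\in\mathbb{R}^n$), then $f(x_k)=f(x_0)$ for $k=0,\dots,K$.
   Context: $\|\cdot\|$ on vectors is the Euclidean norm. $J(x)$ is the $m\times n$ Jacobian matrix of $f$ at $x$, assumed to have full rank $m$ for every $x$. Then $J(x)J(x)^\top$ is invertible and one sets $J(x)^+=J(x)^\top(J(x)J(x)^\top)^{-1}$ and $$N(x)=J(x)^+J(x)=J(x)^\top(J(x)J(x)^\top)^{-1}J(x),\qquad T(x)=I-N(x),\qquad R(x)=I-2N(x).$$ Thus $N(x)$ is the orthogonal projection of $\mathbb{R}^n$ onto the normal space (the orthogonal complement of $\ker J(x)$), $T(x)$ is the orthogonal projection onto the tangent space $\ker J(x)$, and $R(x)$ is the reflection on $\ker J(x)$. $H(x)$ is the second derivative of $f$ at $x$: the symmetric bilinear map $\mathbb{R}^n\times\mathbb{R}^n\to\mathbb{R}^m$ with $f(x+w)=f(x)+J(x)w+\frac12H(x)[w,w]+o(\|w\|^2)$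 as $w\to0$; that is, the $i$-th component of $H(x)[u,w]$ is $u^\top\nabla^2f_i(x)w$, $i=1,\dots,m$. For a symmetric bilinear map $S:\mathbb{R}^n\times\mathbb{R}^n\to\mathbb{R}^m$, $\|S\|=\sup\{\|S[w_1,w_2]\|:\|w_1\|\le1,\|w_2\|\le1\}$. "Volume preserving" means preserving Lebesgue measure on $\mathbb{R}^n\times\mathbb{R}^n$. *)

theory Defs
  imports "HOL-Analysis.Analysis"
begin

text \<open>
  In finite dimension, \<open>f\<close> is of class \<open>C\<^sup>k\<close> iff it is everywhere differentiable and all its
  directional derivatives \<open>x \<mapsto> Df(x) w\<close> are of class \<open>C\<^sup>k\<^sup>-\<^sup>1\<close>.
\<close>

primrec Ck :: "nat \<Rightarrow> ('a::euclidean_space \<Rightarrow> 'b::euclidean_space) \<Rightarrow> bool" where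
  "Ck 0 f \<longleftrightarrow> continuous_on UNIV f"
| "Ck (Suc k) f \<longleftrightarrow>
     (\<forall>x. f differentiable (at x)) \<and> (\<forall>w. Ck k (\<lambda>x. frechet_derivative f (at x) w))"

definition smooth :: "('a::euclidean_space \<Rightarrow> 'b::euclidean_space) \<Rightarrow> bool" where
  "smooth f \<longleftrightarrow> (\<forall>k. Ck k f)"

abbreviation jac :: "(real^'n \<Rightarrow> real^'m) \<Rightarrow> real^'n \<Rightarrow> real^'n^'m" where
  "jac f x \<equiv> jacobian f (at x)"

definition jac_pinv :: "(real^'n \<Rightarrow> real^'m) \<Rightarrow> real^'n \<Rightarrow> real^'m^'n" where
  "jac_pinv f x = transpose (jac f x) ** matrix_inv (jac f x ** transpose (jac f x))"

definition normal_proj :: "(real^'n \<Rightarrow> real^'m) \<Rightarrow> real^'n \<Rightarrow> real^'n^'n" where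
  "normal_proj f x = jac_pinv f x ** jac f x"

definition tangent_proj :: "(real^'n \<Rightarrow> real^'m) \<Rightarrow> real^'n \<Rightarrow> real^'n^'n" where
  "tangent_proj f x = mat 1 - normal_proj f x"

definition reflection :: "(real^'n \<Rightarrow> real^'m) \<Rightarrow> real^'n \<Rightarrow> real^'n^'n" where
  "reflection f x = mat 1 - 2 *\<^sub>R normal_proj f x"

definition partial_deriv :: "'n \<Rightarrow> (real^'n \<Rightarrow> real) \<Rightarrow> real^'n \<Rightarrow> real" where
  "partial_deriv i g x = frechet_derivative g (at x) (axis i 1)"

definition hessian :: "(real^'n \<Rightarrow> real) \<Rightarrow> real^'n \<Rightarrow> real^'n^'n" where
  "hessian g x = (\<chi> i j. partial_deriv i (partial_deriv j g) x)"

definition second_deriv ::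
  "(real^'n \<Rightarrow> real^'m) \<Rightarrow> real^'n \<Rightarrow> real^'n \<Rightarrow> real^'n \<Rightarrow> real^'m" where
  "second_deriv f x u w = (\<chi> i. u \<bullet> (hessian (\<lambda>y. f y $ i) x *v w))"

text \<open>
  The supremum is a conditionally complete one on the reals; it is meaningful because a bilinear
  map on a finite-dimensional space is bounded on the product of the unit balls.
\<close>

definition bilinear_norm :: "(real^'n \<Rightarrow> real^'n \<Rightarrow> real^'m) \<Rightarrow> real" where
  "bilinear_norm S = Sup {norm (S w1 w2) | w1 w2. norm w1 \<le> 1 \<and> norm w2 \<le> 1}"

definition Psi ::
  "(real^'n \<Rightarrow> real^'m) \<Rightarrow> real \<Rightarrow> (real^'n) \<times> (real^'n) \<Rightarrow> (real^'n) \<times> (real^'n)" where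
  "Psi f \<delta> = (\<lambda>(x, v).
     let v' = reflection f (x + (\<delta> / 2) *\<^sub>R v) *v v
     in (x + (\<delta> / 2) *\<^sub>R v + (\<delta> / 2) *\<^sub>R v', v'))"

definition volume_preserving :: "('a::euclidean_space \<Rightarrow> 'a) \<Rightarrow> bool" where
  "volume_preserving g \<longleftrightarrow>
     g \<in> lebesgue \<rightarrow>\<^sub>M lebesgue \<and> distr lebesgue lebesgue g = lebesgue"

end

theory Submission
  imports Defs
begin

text \<open>
  \<open>\<Psi>\<close> is the composition of a shear, the fibrewise reflection \<open>(x, v) \<mapsto> (x, R(x) v)\<close> and the same
  shear; by Fubini's theorem each factor preserves volume because translations and orthogonal maps
  do. Since \<open>R(y)\<close> is an isometric involution with \<open>J(y) R(y) = - J(y)\<close>, reversibility and the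
  conservation of the speed are immediate, and in the Taylor expansion of \<open>f\<close> around a midpoint
  \<open>x\<^sub>k\<^sub>+\<^sub>1\<^sub>/\<^sub>2\<close> the first-order terms of \<open>f(x\<^sub>k\<^sub>+\<^sub>1) - f(x\<^sub>k)\<close> cancel. Only second-order
  remainders are left. When they are summed over \<open>k\<close>, the remainders of the two halves of each
  segment from \<open>x\<^sub>k\<^sub>-\<^sub>1\<^sub>/\<^sub>2\<close> to \<open>x\<^sub>k\<^sub>+\<^sub>1\<^sub>/\<^sub>2\<close> are subtracted from each other, which gains a
  power of \<open>\<delta>\<close> by the Lipschitz bound; the two extreme half segments contribute the \<open>\<beta>\<close> term.
\<close>

section \<open>The projections and the reflection\<close>

text \<open>The inner product of x with A A^T x is the squared norm of A^T x, and full row rank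
  makes A^T injective, so the kernel is trivial.\<close>

lemma invertible_gram:
  fixes A :: "real^'n^'m"
  assumes "rank A = CARD('m)"
  shows "invertible (A ** transpose A)"
proof -
  have inj: "inj ((*v) (transpose A))"
    using assms by (simp flip: full_rank_injective add: rank_transpose)
  have "x = 0" if "(A ** transpose A) *v x = 0" for x
  proof -
    have "norm (transpose A *v x) ^ 2 = x \<bullet> ((A ** transpose A) *v x)"
      by (metis dot_lmul_matrix matrix_vector_mul_assoc power2_norm_eq_inner transpose_matrix_vector
          transpose_transpose)
    then have "transpose A *v x = transpose A *v 0"
      using that by simp
    with inj show ?thesis
      by (blast dest: injD)
  qed
  then show ?thesis
    by (metis invertible_left_inverse matrix_left_invertible_ker)
qed

lemma matrix_inv_invertible:
  fixes A :: "real^'n^'n"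
  assumes "invertible A"
  shows "A ** matrix_inv A = mat 1" and "matrix_inv A ** A = mat 1"
  using assms unfolding invertible_def matrix_inv_def by (metis (mono_tags, lifting) someI_ex)+

lemma transpose_matrix_inv_symmetric:
  fixes A :: "real^'n^'n"
  assumes "invertible A" and "transpose A = A"
  shows "transpose (matrix_inv A) = matrix_inv A"
proof -
  have "transpose (matrix_inv A) ** A = mat 1"
    by (metis assms matrix_inv_invertible(1) matrix_transpose_mul transpose_mat)
  then show ?thesis
    by (metis assms(1) matrix_inv_invertible(1) matrix_mul_assoc matrix_mul_lid matrix_mul_rid)
qed

lemma reflection_mult:
  "reflection f x *v v = v - 2 *\<^sub>R (normal_proj f x *v v)"
  by (simp add: reflection_def matrix_vector_mult_diff_rdistrib scaleR_matrix_vector_assoc)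

lemma tangent_proj_mult:
  "tangent_proj f x *v v = v - normal_proj f x *v v"
  by (simp add: tangent_proj_def matrix_vector_mult_diff_rdistrib)

lemma add_reflection: "v + reflection f x *v v = 2 *\<^sub>R (tangent_proj f x *v v)"
  by (simp add: tangent_proj_mult reflection_mult scaleR_2)

context
  fixes f :: "real^'n \<Rightarrow> real^'m" and x :: "real^'n"
  assumes rank: "rank (jac f x) = CARD('m)"
begin

text \<open>In J N = (J J^T)(J J^T)^{-1} J the Gram matrix cancels against its inverse. Idempotence
  of N and J R = -J both follow from this identity.\<close>

lemma jac_normal_proj: "jac f x ** normal_proj f x = jac f x"
  using matrix_inv_invertible(1)[OF invertible_gram[OF rank]]
  by (metis jac_pinv_def normal_proj_def matrix_mul_assoc matrix_mul_lid)

lemma normal_proj_idem: "normal_proj f x ** normal_proj f x = normal_proj f x"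
  by (metis jac_normal_proj matrix_mul_assoc normal_proj_def)

lemma transpose_normal_proj: "transpose (normal_proj f x) = normal_proj f x"
proof -
  let ?G = "jac f x ** transpose (jac f x)"
  have "transpose (matrix_inv ?G) = matrix_inv ?G"
    by (intro transpose_matrix_inv_symmetric invertible_gram rank)
      (simp add: matrix_transpose_mul transpose_transpose)
  then show ?thesis
    by (simp add: normal_proj_def jac_pinv_def matrix_transpose_mul transpose_transpose
        matrix_mul_assoc)
qed

lemma normal_proj_reflection:
  "normal_proj f x *v (reflection f x *v v) = - (normal_proj f x *v v)"
  unfolding reflection_mult matrix_vector_mult_diff_distrib matrix_vector_mult_scaleR
    matrix_vector_mul_assoc normal_proj_idem
  by (simp add: scaleR_2)

lemma tangent_proj_reflection:
  "tangent_proj f x *v (reflection f x *v v) = tangent_proj f x *v v"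
  unfolding tangent_proj_mult normal_proj_reflection
  by (simp add: reflection_mult scaleR_2)

lemma jac_reflection: "jac f x *v (reflection f x *v v) = - (jac f x *v v)"
  unfolding reflection_mult matrix_vector_mult_diff_distrib matrix_vector_mult_scaleR
    matrix_vector_mul_assoc jac_normal_proj
  by (simp add: scaleR_2)

lemma reflection_involution: "reflection f x *v (reflection f x *v v) = v"
  by (subst reflection_mult) (simp add: normal_proj_reflection, simp add: reflection_mult)

text \<open>As N is symmetric and idempotent, |Nv|^2 = <v, Nv>, so the terms -4 <v, Nv> and 4 |Nv|^2
  in the expansion of |v - 2 Nv|^2 cancel.\<close>

lemma norm_reflection: "norm (reflection f x *v v) = norm v"
proof -
  let ?N = "(*v) (normal_proj f x)"
  have "?N v \<bullet> ?N v = v \<bullet> ?N v"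
    by (metis dot_lmul_matrix matrix_vector_mul_assoc normal_proj_idem
        transpose_normal_proj transpose_matrix_vector)
  then have "(reflection f x *v v) \<bullet> (reflection f x *v v) = v \<bullet> v"
    by (simp add: reflection_mult inner_diff_left inner_diff_right inner_commute)
  then show ?thesis
    by (simp add: norm_eq)
qed

lemma orthogonal_transformation_reflection: "orthogonal_transformation ((*v) (reflection f x))"
  by (simp add: orthogonal_transformation norm_reflection)

end

section \<open>Volume preservation\<close>

text \<open>\<open>volume_preserving\<close> speaks of the completed measure, while the Fubini
  arguments run on Borel sets. Equal image measures have equal null sets, which lets
  \<open>g\<close> pass to the completion.\<close>

lemma volume_preserving_borel:
  fixes g :: "'a::euclidean_space \<Rightarrow> 'a"
  assumes [measurable]: "g \<in> borel_measurable borel" and eq: "distr lborel borel g = lborel"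
  shows "volume_preserving g"
proof -
  have g: "g \<in> lebesgue \<rightarrow>\<^sub>M lborel"
    by (intro measurable_completion) simp
  have d: "distr lebesgue lborel g = lborel"
  proof -
    have "distr lebesgue lborel g = distr lborel lborel g"
      by (intro distr_completion) simp
    also have "\<dots> = distr lborel borel g"
      by (intro distr_cong) auto
    finally show ?thesis
      using eq by simp
  qed
  have "g \<in> lebesgue \<rightarrow>\<^sub>M lebesgue"
    by (rule completion.measurable_completion2[OF g]) (simp add: d)
  moreover have "distr lebesgue lebesgue g = lebesgue"
    using completion.completion_distr_eq[OF g] by (simp add: d)
  ultimately show ?thesis
    by (simp add: volume_preserving_def)
qed

section \<open>Maps preserving Lebesgue measure: orthogonal maps, fibrewise maps, shears\<close>

lemma distr_lborel_comp:
  assumes [measurable]: "g \<in> borel_measurable borel" "h \<in> borel_measurable borel"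
    and "distr lborel borel g = lborel" "distr lborel borel h = lborel"
  shows "distr lborel borel (\<lambda>x. h (g x)) = lborel"
  using distr_distr[of h borel borel g lborel] assms(3,4)
  by (simp add: comp_def)

lemma nn_integral_lborel_plus:
  fixes F :: "'a::euclidean_space \<Rightarrow> ennreal"
  assumes [measurable]: "F \<in> borel_measurable borel"
  shows "(\<integral>\<^sup>+x. F (c + x) \<partial>lborel) = (\<integral>\<^sup>+x. F x \<partial>lborel)"
  by (subst lborel_distr_plus[of c, symmetric]) (simp add: nn_integral_distr)

text \<open>
  The uniqueness argument for Haar measure: by translation invariance and Fubini's theorem, the
  image measure is a multiple of Lebesgue measure, and the unit ball shows that the factor is 1.
\<close>

lemma distr_lborel_orthogonal_transformation:
  fixes g :: "'a::euclidean_space \<Rightarrow> 'a"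
  assumes g: "orthogonal_transformation g"
  shows "distr lborel borel g = lborel"
proof (rule measure_eqI)
  have lin: "linear g"
    using g by (rule orthogonal_transformation_linear)
  have g_meas[measurable]: "g \<in> borel_measurable borel"
    by (intro borel_measurable_continuous_onI linear_continuous_on)
      (simp add: lin flip: linear_conv_bounded_linear)
  fix A :: "'a set"
  assume "A \<in> sets (distr lborel borel g)"
  then have A[measurable]: "A \<in> sets borel"
    by simp
  \<comment> \<open>The unit ball is a test set of positive finite measure, invariant under x |-> -
    g x because \<open>g\<close> preserves norms.\<close>
  define U :: "'a set" where "U = ball 0 1"
  have U[measurable]: "U \<in> sets borel"
    by (simp add: U_def)
  have gA[measurable]: "g -` A \<in> sets borel"
    using measurable_sets_borel[OF g_meas A] .
  let ?A = "indicator A :: 'a \<Rightarrow> ennreal" and ?U = "indicator U :: 'a \<Rightarrow> ennreal"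
  have gU: "?U (- g x) = ?U x" for x
    using g by (simp add: U_def orthogonal_transformation_norm indicator_def)
  have m1: "(\<lambda>(x, y). ?A (g x) * ?U (y - g x)) \<in> borel_measurable (lborel \<Otimes>\<^sub>M lborel)"
    by measurable
  have m2: "(\<lambda>(x, y). ?A (g x + y) * ?U (- g x)) \<in> borel_measurable (lborel \<Otimes>\<^sub>M lborel)"
    by measurable
  have "emeasure lborel (g -` A) * emeasure lborel U =
      (\<integral>\<^sup>+x. ?A (g x) * emeasure lborel U \<partial>lborel)"
    by (subst nn_integral_multc) (simp_all add: indicator_vimage[symmetric, unfolded comp_def])
  also have "\<dots> = (\<integral>\<^sup>+x. \<integral>\<^sup>+y. ?A (g x) * ?U (y - g x) \<partial>lborel \<partial>lborel)"
    using nn_integral_lborel_plus[of ?U "- g _"]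
    by (simp add: nn_integral_cmult)
  also have "\<dots> = (\<integral>\<^sup>+y. \<integral>\<^sup>+x. ?A (g x) * ?U (y - g x) \<partial>lborel \<partial>lborel)"
    by (rule lborel_pair.Fubini'[OF m1, symmetric])
  also have "\<dots> = (\<integral>\<^sup>+y. \<integral>\<^sup>+x. ?A (g x + y) * ?U (- g x) \<partial>lborel \<partial>lborel)"
  proof (rule nn_integral_cong)
    fix y
    \<comment> \<open>By linearity, translating x by a preimage z of y replaces \<open>g x\<close>
      by \<open>g x + y\<close>, which moves y from the ball factor to the factor of
      \<open>A\<close>.\<close>
    obtain z where z: "g z = y"
      using orthogonal_transformation_surj[OF g] by (metis surjD)
    show "(\<integral>\<^sup>+x. ?A (g x) * ?U (y - g x) \<partial>lborel) =
        (\<integral>\<^sup>+x. ?A (g x + y) * ?U (- g x) \<partial>lborel)"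
      using nn_integral_lborel_plus[of "\<lambda>x. ?A (g x) * ?U (y - g x)" z]
      by (simp add: linear_add[OF lin] z add.commute)
  qed
  also have "\<dots> = (\<integral>\<^sup>+x. \<integral>\<^sup>+y. ?A (g x + y) * ?U (- g x) \<partial>lborel \<partial>lborel)"
    by (rule lborel_pair.Fubini'[OF m2])
  also have "\<dots> = (\<integral>\<^sup>+x. emeasure lborel A * ?U x \<partial>lborel)"
    by (subst nn_integral_multc) (simp_all add: nn_integral_lborel_plus gU)
  also have "\<dots> = emeasure lborel A * emeasure lborel U"
    by (simp add: nn_integral_cmult)
  finally have "emeasure lborel (g -` A) * emeasure lborel U =
    emeasure lborel A * emeasure lborel U" .
  moreover have "emeasure lborel U \<noteq> 0" "emeasure lborel U \<noteq> \<infinity>"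
    unfolding U_def
    using emeasure_lborel_ball_finite[of "0::'a" 1] content_ball_pos[of 1 "0::'a"]
    by (auto simp: measure_def)
  ultimately have "emeasure lborel (g -` A) = emeasure lborel A"
    by (simp add: mult.commute[of _ "emeasure lborel U"] ennreal_mult_cancel_left)
  then show "emeasure (distr lborel borel g) A = emeasure lborel A"
    by (simp add: emeasure_distr)
qed simp

text \<open>By Fubini's theorem the measure of a set is the integral of the measures of its sections
  over x. The section of the preimage is the preimage of the section under \<open>h x\<close>, so
  the integrands agree pointwise.\<close>

lemma distr_lborel_fibre_snd:
  fixes h :: "'a::euclidean_space \<Rightarrow> 'b::euclidean_space \<Rightarrow> 'b"
  assumes h: "(\<lambda>(x, v). h x v) \<in> borel_measurable borel"
    and eq: "\<And>x. distr lborel borel (h x) = lborel"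
  shows "distr lborel borel (\<lambda>(x, v). (x, h x v)) = lborel"
proof (rule measure_eqI)
  let ?g = "\<lambda>(x, v). (x, h x v)"
  have hm[measurable]: "(\<lambda>p. h (fst p) (snd p)) \<in> borel_measurable borel"
    using h by (simp add: case_prod_beta')
  have g[measurable]: "?g \<in> borel_measurable borel"
    unfolding case_prod_beta'
    by (intro borel_measurable_Pair hm borel_measurable_continuous_onI continuous_intros)
  have hx[measurable]: "h x \<in> borel_measurable borel" for x
    using measurable_compose[OF _ hm, of "\<lambda>v. (x, v)" borel] by simp
  fix A :: "('a \<times> 'b) set"
  assume "A \<in> sets (distr lborel borel ?g)"
  then have A: "A \<in> sets borel"
    by simp
  have "?g -` A \<in> sets borel"
    using measurable_sets_borel[OF g A] .
  then have "emeasure lborel (?g -` A) = (\<integral>\<^sup>+x. emeasure lborel (Pair x -` (?g -` A)) \<partial>lborel)"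
    unfolding lborel_prod[symmetric]
    by (intro lborel.emeasure_pair_measure_alt) (simp only: lborel_prod sets_lborel)
  also have "\<dots> = (\<integral>\<^sup>+x. emeasure lborel (Pair x -` A) \<partial>lborel)"
  proof (rule nn_integral_cong)
    fix x :: 'a
    have [measurable]: "Pair x -` A \<in> sets borel"
      using measurable_sets_borel[OF _ A, of "Pair x"] by simp
    have "Pair x -` (?g -` A) = h x -` (Pair x -` A)"
      by auto
    also have "emeasure lborel \<dots> = emeasure (distr lborel borel (h x)) (Pair x -` A)"
      by (simp add: emeasure_distr)
    finally show "emeasure lborel (Pair x -` (?g -` A)) = emeasure lborel (Pair x -` A)"
      by (simp add: eq)
  qed
  also have "\<dots> = emeasure lborel A"
    unfolding lborel_prod[symmetric]
    using A by (intro lborel.emeasure_pair_measure_alt[symmetric]) (simp only: lborel_prod sets_lborel)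
  finally show "emeasure (distr lborel borel ?g) A = emeasure lborel A"
    using A by (simp add: emeasure_distr)
qed simp

lemma distr_lborel_swap:
  "distr lborel borel (\<lambda>(x, y). (y, x)) =
    (lborel :: ('b::euclidean_space \<times> 'a::euclidean_space) measure)"
proof -
  have "distr (lborel \<Otimes>\<^sub>M lborel) (lborel \<Otimes>\<^sub>M lborel) (\<lambda>(x::'a, y::'b). (y, x)) =
    lborel \<Otimes>\<^sub>M lborel"
    by (rule lborel_pair.distr_pair_swap[symmetric])
  then show ?thesis
    unfolding lborel_prod by (subst distr_cong[OF refl _ refl, of borel lborel]) auto
qed

text \<open>Conjugation with the coordinate swap turns the shear into a fibrewise map, which
  translates x by c v in the fibre over v.\<close>

lemma distr_lborel_shear:
  fixes c :: real
  shows "distr lborel borel (\<lambda>(x, v). (x + c *\<^sub>R v, v)) =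
    (lborel :: ('a::euclidean_space \<times> 'a) measure)"
proof -
  let ?s = "\<lambda>(x::'a, y::'a). (y, x)" and ?h = "\<lambda>(v::'a, x::'a). (v, c *\<^sub>R v + x)"
  have [measurable]: "?s \<in> borel_measurable borel" "?h \<in> borel_measurable borel"
    unfolding case_prod_beta' by (intro borel_measurable_continuous_onI continuous_intros)+
  have "distr lborel borel ?h = lborel"
    by (rule distr_lborel_fibre_snd) (auto simp: case_prod_beta' lborel_distr_plus
        intro!: borel_measurable_continuous_onI continuous_intros)
  then have "distr lborel borel (\<lambda>p. ?h (?s p)) = lborel"
    by (intro distr_lborel_comp[where g = ?s and h = ?h] distr_lborel_swap) auto
  then have "distr lborel borel (\<lambda>p. ?s (?h (?s p))) = lborel"
    by (intro distr_lborel_comp[where g = "\<lambda>p. ?h (?s p)" and h = ?s] distr_lborel_swap) auto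
  then show ?thesis
    by (simp add: case_prod_beta' add.commute)
qed

section \<open>Continuity of matrix expressions\<close>

lemma continuous_on_det:
  fixes A :: "'a::topological_space \<Rightarrow> real^'n^'n"
  assumes "\<And>i j. continuous_on S (\<lambda>x. A x $ i $ j)"
  shows "continuous_on S (\<lambda>x. det (A x))"
  unfolding det_def by (intro continuous_intros assms)

text \<open>Cramer's rule gives every component as a quotient of determinants, which are polynomials
  in the entries of A and b.\<close>

lemma continuous_on_matrix_inv_mult:
  fixes A :: "'a::topological_space \<Rightarrow> real^'n^'n"
  assumes A: "\<And>i j. continuous_on S (\<lambda>x. A x $ i $ j)"
    and b: "continuous_on S b" and inv: "\<And>x. x \<in> S \<Longrightarrow> invertible (A x)"
  shows "continuous_on S (\<lambda>x. matrix_inv (A x) *v b x)"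
proof -
  have "continuous_on S (\<lambda>x. \<chi> k. det (\<chi> i j. if j = k then b x $ i else A x $ i $ j) / det (A x))"
  proof (intro continuous_on_vec_lambda continuous_on_divide continuous_on_det A)
    show "continuous_on S (\<lambda>x. (\<chi> i j. if j = k then b x $ i else A x $ i $ j) $ i $ j)" for k i j
      by (cases "j = k") (auto intro!: A b continuous_intros)
    show "\<forall>x\<in>S. det (A x) \<noteq> 0"
      using inv by (simp add: invertible_det_nz)
  qed
  moreover have "matrix_inv (A x) *v b x =
      (\<chi> k. det (\<chi> i j. if j = k then b x $ i else A x $ i $ j) / det (A x))" if "x \<in> S" for x
    using inv[OF that]
    by (intro cramer[THEN iffD1])
      (simp_all add: invertible_det_nz matrix_vector_mul_assoc matrix_inv_invertible)
  ultimately show ?thesis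
    by (simp cong: continuous_on_cong)
qed

lemma continuous_on_matrix_vector_mult:
  fixes A :: "'a::topological_space \<Rightarrow> real^'n^'m"
  assumes "\<And>i j. continuous_on S (\<lambda>x. A x $ i $ j)" and "continuous_on S b"
  shows "continuous_on S (\<lambda>x. A x *v b x)"
  unfolding matrix_vector_mult_def by (intro continuous_intros assms)

section \<open>Smooth maps, their Jacobians and the continuity of the reflection\<close>

lemma smooth_Ck: "smooth f \<Longrightarrow> Ck k f"
  by (simp add: smooth_def)

lemma smooth_differentiable: "smooth f \<Longrightarrow> f differentiable (at x)"
  using smooth_Ck[of f "Suc 0"] by simp

text \<open>A directional derivative costs one level of \<open>Ck\<close>, and \<open>smooth\<close>
  provides every level.\<close>

lemma smooth_frechet_derivative: "smooth f \<Longrightarrow> smooth (\<lambda>x. frechet_derivative f (at x) w)"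
  unfolding smooth_def by (metis Ck.simps(2))

lemma smooth_continuous: "smooth f \<Longrightarrow> continuous_on S f"
  using smooth_Ck[of f 0] continuous_on_subset by fastforce

lemma smooth_has_derivative: "smooth f \<Longrightarrow> (f has_derivative (*v) (jac f x)) (at x)"
  by (simp add: smooth_differentiable flip: jacobian_works)

lemma frechet_derivative_eq_jac: "smooth f \<Longrightarrow> frechet_derivative f (at x) = (*v) (jac f x)"
  using frechet_derivative_at[OF smooth_has_derivative] by metis

lemma continuous_on_jac_nth:
  assumes "smooth f"
  shows "continuous_on S (\<lambda>x. jac f x $ i $ j)"
proof -
  have "jac f x $ i $ j = frechet_derivative f (at x) (axis j 1) $ i" for x
    by (simp add: jacobian_def matrix_def)
  then show ?thesis
    by (simp add: continuous_on_component[OF smooth_continuous[OF smooth_frechet_derivative[OF assms]]])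
qed

lemma continuous_on_reflection_mult:
  fixes f :: "real^'n \<Rightarrow> real^'m"
  assumes smooth: "smooth f" and rank: "\<And>x. rank (jac f x) = CARD('m)"
  shows "continuous_on UNIV (\<lambda>(x, v). reflection f x *v v)"
proof -
  have J: "continuous_on UNIV (\<lambda>p::(real^'n) \<times> (real^'n). jac f (fst p) $ i $ j)" for i j
    by (rule continuous_on_compose2[OF continuous_on_jac_nth[OF smooth, of UNIV]])
      (auto intro: continuous_intros)
  note matrix_intros = continuous_on_matrix_vector_mult continuous_on_matrix_inv_mult J
  \<comment> \<open>The product is bracketed from the right, so that the inverse Gram matrix acts on
    a vector and Cramer's rule applies.\<close>
  have "continuous_on UNIV (\<lambda>p. transpose (jac f (fst p)) *v
      (matrix_inv (jac f (fst p) ** transpose (jac f (fst p))) *v (jac f (fst p) *v snd p)))"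
    by (intro matrix_intros invertible_gram rank)
      (auto simp: transpose_def matrix_matrix_mult_def intro!: J continuous_intros)
  then show ?thesis
    unfolding case_prod_beta' reflection_mult normal_proj_def jac_pinv_def
      matrix_vector_mul_assoc[symmetric]
    by (intro continuous_intros)
qed

section \<open>Volume preservation and reversibility of \<open>Psi\<close>\<close>

theorem volume_preserving_Psi:
  fixes f :: "real^'n \<Rightarrow> real^'m"
  assumes smooth: "smooth f" and rank: "\<And>x. rank (jac f x) = CARD('m)"
  shows "volume_preserving (Psi f \<delta>)"
proof -
  let ?s = "\<lambda>(x :: real^'n, v). (x + (\<delta> / 2) *\<^sub>R v, v)"
  let ?r = "\<lambda>(x, v). (x, reflection f x *v v)"
  have s: "?s \<in> borel_measurable borel"
    unfolding case_prod_beta' by (intro borel_measurable_continuous_onI continuous_intros)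
  have r: "?r \<in> borel_measurable borel"
    using continuous_on_reflection_mult[OF smooth rank]
    unfolding case_prod_beta' by (intro borel_measurable_continuous_onI continuous_intros)
  have "distr lborel borel ?r = lborel"
    by (intro distr_lborel_fibre_snd borel_measurable_continuous_onI continuous_on_reflection_mult
        distr_lborel_orthogonal_transformation orthogonal_transformation_reflection smooth rank)
  then have sr: "distr lborel borel (\<lambda>p. ?r (?s p)) = lborel"
    by (intro distr_lborel_comp[where g = ?s and h = ?r] s r distr_lborel_shear)
  have rs: "(\<lambda>p. ?r (?s p)) \<in> borel_measurable borel"
    using measurable_compose[OF s r] .
  have Psi: "Psi f \<delta> = (\<lambda>p. ?s (?r (?s p)))"
    by (auto simp: Psi_def Let_def)
  show ?thesis
    unfolding Psi using measurable_compose[OF rs s]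
    by (intro volume_preserving_borel distr_lborel_comp[where g = "\<lambda>p. ?r (?s p)" and h = ?s]
        rs s sr distr_lborel_shear)
qed

text \<open>Started at (x', -v'), the first half step leads back to the midpoint of the forward
  step. The reflection there is linear and its own inverse, hence sends -v' to -v.\<close>

lemma Psi_reversible:
  fixes f :: "real^'n \<Rightarrow> real^'m"
  assumes rank: "\<And>x. rank (jac f x) = CARD('m)"
    and eq: "Psi f \<delta> (x, v) = (x', v')"
  shows "Psi f \<delta> (x', - v') = (x, - v)"
proof -
  let ?y = "x + (\<delta> / 2) *\<^sub>R v"
  have v': "v' = reflection f ?y *v v" and x': "x' = ?y + (\<delta> / 2) *\<^sub>R v'"
    using eq by (auto simp: Psi_def Let_def)
  have "reflection f ?y *v (- v') = - v"
    using reflection_involution[OF rank, where v = v and x = ?y]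
    by (simp add: v' vec.neg)
  moreover have "x' + (\<delta> / 2) *\<^sub>R (- v') = ?y"
    by (simp add: x')
  ultimately show ?thesis
    by (simp add: Psi_def Let_def)
qed

section \<open>Second-order Taylor expansion\<close>

lemma frechet_derivative_nth:
  assumes "f differentiable (at x)"
  shows "frechet_derivative (\<lambda>y. f y $ i) (at x) u = frechet_derivative f (at x) u $ i"
proof -
  have "((\<lambda>y. f y $ i) has_derivative (\<lambda>u. frechet_derivative f (at x) u $ i)) (at x)"
    using assms
    by (intro bounded_linear.has_derivative[OF bounded_linear_vec_nth])
      (simp flip: frechet_derivative_works)
  then show ?thesis
    by (metis frechet_derivative_at)
qed

lemma linear_sum_axis:
  fixes g :: "real^'n \<Rightarrow> 'b::real_vector"
  assumes "linear g"
  shows "g u = (\<Sum>j\<in>UNIV. u $ j *\<^sub>R g (axis j 1))"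
proof -
  have "g u = g (\<Sum>j\<in>UNIV. u $ j *\<^sub>R axis j 1)"
    by (simp add: basis_expansion flip: scalar_mult_eq_scaleR)
  then show ?thesis
    by (simp add: linear_sum[OF assms] linear_scale[OF assms])
qed

text \<open>This links the coordinate definition of \<open>second_deriv\<close> to iterated
  directional derivatives: the index order in \<open>hessian\<close> pairs \<open>u\<close> with the
  outer derivative and \<open>w\<close> with the inner one.\<close>

lemma frechet_derivative_has_derivative:
  assumes "smooth f"
  shows "((\<lambda>x. frechet_derivative f (at x) w) has_derivative (\<lambda>u. second_deriv f x u w)) (at x)"
proof -
  let ?D = "\<lambda>w x. frechet_derivative f (at x) w"
  let ?H = "\<lambda>w. frechet_derivative (?D w) (at x)"
  have H: "(?D w has_derivative ?H w) (at x)" for w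
    using smooth_differentiable[OF smooth_frechet_derivative[OF assms]]
    by (simp flip: frechet_derivative_works)
  have D: "linear (\<lambda>w. ?D w y)" for y
    using smooth_differentiable[OF assms] by (rule linear_frechet_derivative)
  \<comment> \<open>Expanding \<open>w\<close> in the standard basis reduces to the axis directions
    that \<open>partial_deriv\<close> uses.\<close>
  have "?D w = (\<lambda>y. \<Sum>k\<in>UNIV. w $ k *\<^sub>R ?D (axis k 1) y)"
    using linear_sum_axis[OF D] by (rule ext)
  moreover have "((\<lambda>y. \<Sum>k\<in>UNIV. w $ k *\<^sub>R ?D (axis k 1) y) has_derivative
      (\<lambda>u. \<Sum>k\<in>UNIV. w $ k *\<^sub>R ?H (axis k 1) u)) (at x)"
    by (intro has_derivative_sum has_derivative_scaleR_right H)
  ultimately have "(?D w has_derivative (\<lambda>u. \<Sum>k\<in>UNIV. w $ k *\<^sub>R ?H (axis k 1) u)) (at x)"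
    by simp
  moreover have "(\<Sum>k\<in>UNIV. w $ k *\<^sub>R ?H (axis k 1) u) = second_deriv f x u w" for u
  proof -
    have "hessian (\<lambda>y. f y $ i) x $ j $ k = ?H (axis k 1) (axis j 1) $ i" for i j k
    proof -
      have "partial_deriv k (\<lambda>y. f y $ i) = (\<lambda>y. ?D (axis k 1) y $ i)"
        using smooth_differentiable[OF assms] by (simp add: fun_eq_iff partial_deriv_def frechet_derivative_nth)
      then show ?thesis
        using smooth_differentiable[OF smooth_frechet_derivative[OF assms]]
        by (simp add: hessian_def partial_deriv_def frechet_derivative_nth)
    qed
    moreover have "?H (axis k 1) u = (\<Sum>j\<in>UNIV. u $ j *\<^sub>R ?H (axis k 1) (axis j 1))" for k
      by (rule linear_sum_axis[OF has_derivative_linear[OF H]])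
    ultimately have "second_deriv f x u w $ i = (\<Sum>k\<in>UNIV. w $ k *\<^sub>R ?H (axis k 1) u) $ i" for i
      unfolding second_deriv_def inner_vec_def matrix_vector_mult_def
      by (simp add: sum_distrib_left, subst sum.swap) (simp add: mult_ac)
    then show ?thesis
      by (simp add: vec_eq_iff)
  qed
  ultimately show ?thesis
    by simp
qed

lemma bilinear_second_deriv: "bilinear (second_deriv f x)"
  by (auto simp: bilinear_def second_deriv_def vec_eq_iff inner_add_left inner_add_right
      matrix_vector_right_distrib matrix_vector_mult_scaleR intro!: linearI)

text \<open>Homogeneity reduces the bound to unit vectors; zero arguments cannot be normalised and
  are split off.\<close>

lemma bilinear_norm_bound:
  fixes S :: "real^'n \<Rightarrow> real^'n \<Rightarrow> real^'m"
  assumes "bilinear S"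
  shows "norm (S u w) \<le> bilinear_norm S * norm u * norm w"
proof (cases "u = 0 \<or> w = 0")
  case True
  then show ?thesis
    using assms by (auto simp: bilinear_lzero bilinear_rzero)
next
  case False
  let ?X = "{norm (S w1 w2) | w1 w2. norm w1 \<le> 1 \<and> norm w2 \<le> 1}"
  obtain B where B: "B > 0" "\<And>x y. norm (S x y) \<le> B * norm x * norm y"
    using bilinear_bounded_pos[OF assms] by auto
  have "norm (S x y) \<le> B" if "norm x \<le> 1" "norm y \<le> 1" for x y
  proof -
    have "B * (norm x * norm y) \<le> B * 1"
      using B(1) that mult_le_one[of "norm x" "norm y"] by (intro mult_left_mono) auto
    then show ?thesis
      using B(2)[of x y] by (simp add: mult.assoc)
  qed
  \<comment> \<open>Boundedness is what makes the real \<open>Sup\<close> dominate the members of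
    the set.\<close>
  then have bdd: "bdd_above ?X"
    by (auto intro!: bdd_aboveI[of _ B])
  have "norm (S (u /\<^sub>R norm u) (w /\<^sub>R norm w)) \<le> bilinear_norm S"
    unfolding bilinear_norm_def using False
    by (intro cSup_upper bdd CollectI exI[of _ "u /\<^sub>R norm u"] exI[of _ "w /\<^sub>R norm w"]) simp
  then show ?thesis
    using False by (simp add: bilinear_lmul[OF assms] bilinear_rmul[OF assms] field_simps)
qed

section \<open>Taylor remainders and their estimates\<close>

text \<open>The step \<open>h\<close> is kept apart from the direction \<open>w\<close>, so that
  forward and backward half steps share one \<open>h\<close> and differ only in direction.\<close>

definition taylor_remainder ::
  "(real^'n \<Rightarrow> real^'m) \<Rightarrow> real \<Rightarrow> real^'n \<Rightarrow> real^'n \<Rightarrow> real^'m" where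
  "taylor_remainder f h y w = f (y + h *\<^sub>R w) - f y - h *\<^sub>R (jac f y *v w)"

text \<open>This is Taylor's formula with integral remainder, applied to the restriction of
  \<open>f\<close> to the line through y in direction w.\<close>

lemma taylor_remainder_has_integral:
  assumes f: "smooth f" and h: "0 \<le> h"
  shows "((\<lambda>s. (h - s) *\<^sub>R second_deriv f (y + s *\<^sub>R w) w w) has_integral
    taylor_remainder f h y w) {0..h}"
proof -
  \<comment> \<open>These are \<open>f\<close> along the line and its first two derivatives; indices
    above 2 never occur in the formula of order 2.\<close>
  define Df where "Df k = (\<lambda>s. if k = (0::nat) then f (y + s *\<^sub>R w)
    else if k = 1 then frechet_derivative f (at (y + s *\<^sub>R w)) w
    else second_deriv f (y + s *\<^sub>R w) w w)" for k
  have line: "((\<lambda>s. y + s *\<^sub>R w) has_derivative (\<lambda>s. s *\<^sub>R w)) (at t within S)" for t S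
    by (auto intro!: derivative_eq_intros)
  have chain: "((\<lambda>s. F (y + s *\<^sub>R w)) has_vector_derivative D w) (at t within S)"
    if "(F has_derivative D) (at (y + t *\<^sub>R w))" for F :: "_ \<Rightarrow> real^'m" and D t S
    using has_derivative_compose[OF line that] linear_scale[OF has_derivative_linear[OF that]]
    by (simp add: has_vector_derivative_def)
  have "(Df m has_vector_derivative Df (Suc m) t) (at t within {0..h})" if "m < 2" for m t
  proof (cases "m = 0")
    case True
    with chain[OF smooth_has_derivative[OF f]] show ?thesis
      by (simp add: Df_def frechet_derivative_eq_jac[OF f])
  next
    case False
    with that have "m = 1"
      by simp
    with chain[OF frechet_derivative_has_derivative[OF f]] show ?thesis
      by (simp add: Df_def)
  qed
  then have "((\<lambda>s. ((h - s) ^ (2 - 1) / fact (2 - 1)) *\<^sub>R Df 2 s) has_integral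
      f (y + h *\<^sub>R w) - (\<Sum>i<2. ((h - 0) ^ i / fact i) *\<^sub>R Df i 0)) {0..h}"
    using h by (intro Taylor_has_integral[where f = "\<lambda>s. f (y + s *\<^sub>R w)"]) (auto simp: Df_def)
  then show ?thesis
    by (simp add: Df_def taylor_remainder_def frechet_derivative_eq_jac[OF f]
        eval_nat_numeral algebra_simps)
qed

lemma has_integral_power_diff:
  fixes c h :: real
  assumes "0 \<le> h"
  shows "((\<lambda>s. c * (h - s) ^ k) has_integral c * h ^ Suc k / real (Suc k)) {0..h}"
proof -
  let ?c = "- c / real (Suc k)"
  have "((\<lambda>s. h - s) has_real_derivative - 1) (at s within S)" for s S
    by (auto intro!: derivative_eq_intros)
  from DERIV_cmult[OF DERIV_power[OF this, of "Suc k"], of ?c]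
  have "((\<lambda>s. ?c * (h - s) ^ Suc k) has_real_derivative c * (h - s) ^ k) (at s within S)" for s S
    by (simp del: of_nat_Suc power_Suc)
  then have "((\<lambda>s. c * (h - s) ^ k) has_integral ?c * (h - h) ^ Suc k - ?c * (h - 0) ^ Suc k) {0..h}"
    using assms
    by (intro fundamental_theorem_of_calculus)
      (auto simp flip: has_real_derivative_iff_has_vector_derivative)
  then show ?thesis
    by simp
qed

text \<open>The weight is a general power to serve two estimates: \<open>k = 1\<close> for a single
  remainder, giving h^2 / 2, and \<open>k = 2\<close> for a difference of two, giving h^3 /
  3.\<close>

lemma norm_has_integral_le:
  fixes g :: "real \<Rightarrow> 'a::banach"
  assumes "(g has_integral i) {0..h}" and "0 \<le> h"
    and "\<And>s. 0 \<le> s \<Longrightarrow> s \<le> h \<Longrightarrow> norm (g s) \<le> c * (h - s) ^ k"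
  shows "norm i \<le> c * h ^ Suc k / real (Suc k)"
proof -
  have "norm (integral {0..h} g) \<le> integral {0..h} (\<lambda>s. c * (h - s) ^ k)"
    using assms has_integral_power_diff[OF assms(2), of c k]
    by (intro integral_norm_bound_integral) (auto simp: integrable_on_def)
  then show ?thesis
    using integral_unique[OF assms(1)] integral_unique[OF has_integral_power_diff[OF assms(2), of c k]]
    by (simp only:)
qed

lemma norm_taylor_remainder_le:
  assumes f: "smooth f" and h: "0 \<le> h"
    and \<beta>: "\<And>y. bilinear_norm (second_deriv f y) \<le> \<beta>"
  shows "norm (taylor_remainder f h y w) \<le> \<beta> * (norm w)\<^sup>2 * h\<^sup>2 / 2"
proof -
  have "norm ((h - s) *\<^sub>R second_deriv f (y + s *\<^sub>R w) w w) \<le> \<beta> * (norm w)\<^sup>2 * (h - s) ^ 1"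
    if "s \<le> h" for s
  proof -
    have le: "norm (second_deriv f (y + s *\<^sub>R w) w w) \<le> \<beta> * norm w * norm w"
      by (rule order_trans[OF bilinear_norm_bound[OF bilinear_second_deriv]])
        (intro mult_right_mono \<beta> norm_ge_zero)
    then show ?thesis
      using that mult_right_mono[OF le, of "h - s"] by (simp add: power2_eq_square mult_ac)
  qed
  from norm_has_integral_le[OF taylor_remainder_has_integral[OF f h] h this] show ?thesis
    by (simp add: power2_eq_square)
qed

text \<open>
  The two remainders describe the segment from \<open>y\<close> to \<open>y + 2 h w\<close> as seen from its two endpoints:
  the corresponding points at parameter \<open>s\<close> are at distance \<open>2 (h - s) \<parallel>w\<parallel>\<close> from each other.
\<close>

lemma norm_taylor_remainder_diff_le:
  assumes f: "smooth f" and h: "0 \<le> h"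
    and \<gamma>: "\<And>y z. bilinear_norm (\<lambda>u w. second_deriv f y u w - second_deriv f z u w)
      \<le> \<gamma> * norm (y - z)"
  shows "norm (taylor_remainder f h y w - taylor_remainder f h (y + (2 * h) *\<^sub>R w) (- w))
    \<le> 2 * \<gamma> * norm w ^ 3 * h ^ 3 / 3"
proof -
  let ?z = "y + (2 * h) *\<^sub>R w"
  let ?g = "\<lambda>s. (h - s) *\<^sub>R second_deriv f (y + s *\<^sub>R w) w w -
    (h - s) *\<^sub>R second_deriv f (?z + s *\<^sub>R - w) (- w) (- w)"
  have int: "(?g has_integral taylor_remainder f h y w - taylor_remainder f h ?z (- w)) {0..h}"
    by (intro has_integral_diff taylor_remainder_has_integral f h)
  \<comment> \<open>The kernel h - s times the Lipschitz bound for the distance 2 (h - s) |w| gives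
    the quadratic weight.\<close>
  have "norm (?g s) \<le> 2 * \<gamma> * norm w ^ 3 * (h - s) ^ 2" if s: "s \<le> h" for s
  proof -
    let ?S = "\<lambda>u w'. second_deriv f (y + s *\<^sub>R w) u w' - second_deriv f (?z - s *\<^sub>R w) u w'"
    have "bilinear ?S"
      using bilinear_second_deriv[of f "y + s *\<^sub>R w"] bilinear_second_deriv[of f "?z - s *\<^sub>R w"]
      unfolding bilinear_def by (auto intro: linear_compose_sub)
    moreover have "norm ((y + s *\<^sub>R w) - (?z - s *\<^sub>R w)) = 2 * (h - s) * norm w"
    proof -
      have "(y + s *\<^sub>R w) - (?z - s *\<^sub>R w) = - ((2 * (h - s)) *\<^sub>R w)"
        by (simp add: algebra_simps flip: scaleR_2)
      then show ?thesis
        using s by simp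
    qed
    then have "bilinear_norm ?S \<le> 2 * \<gamma> * (h - s) * norm w"
      using \<gamma>[of "y + s *\<^sub>R w" "?z - s *\<^sub>R w"] by (simp add: mult_ac)
    ultimately have "norm (?S w w) \<le> 2 * \<gamma> * (h - s) * norm w * norm w * norm w"
      by (meson bilinear_norm_bound mult_right_mono norm_ge_zero order_trans)
    then have "(h - s) * norm (?S w w) \<le> (h - s) * (2 * \<gamma> * (h - s) * norm w * norm w * norm w)"
      using s by (intro mult_left_mono) auto
    \<comment> \<open>The second derivative is even on the diagonal, so the reversed direction -w
      may be replaced by w.\<close>
    moreover have "?g s = (h - s) *\<^sub>R ?S w w"
      using bilinear_second_deriv[of f]
      by (simp add: bilinear_lneg bilinear_rneg scaleR_diff_right)
    ultimately show ?thesis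
      using s by (simp add: power2_eq_square power3_eq_cube mult_ac)
  qed
  from norm_has_integral_le[OF int h this] show ?thesis
    by (simp add: eval_nat_numeral mult_ac)
qed

text \<open>The integrand reduces to (h - s) times a constant vector, so the remainder depends on w
  only through its length and not at all on y.\<close>

lemma taylor_remainder_radial:
  assumes f: "smooth f" and h: "0 \<le> h"
    and \<nu>: "\<And>y w. second_deriv f y w w = (norm w)\<^sup>2 *\<^sub>R \<nu>"
  shows "taylor_remainder f h y w = ((norm w)\<^sup>2 * h\<^sup>2 / 2) *\<^sub>R \<nu>"
proof -
  have "((\<lambda>s. ((norm w)\<^sup>2 * (h - s) ^ 1) *\<^sub>R \<nu>) has_integral
      ((norm w)\<^sup>2 * h ^ Suc 1 / real (Suc 1)) *\<^sub>R \<nu>) {0..h}"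
    by (intro has_integral_scaleR_left has_integral_power_diff h)
  with taylor_remainder_has_integral[OF f h, of y w] show ?thesis
    unfolding \<nu> by (auto intro!: has_integral_unique simp: mult.commute power2_eq_square)
qed

section \<open>Trajectories\<close>

text \<open>\<open>xh k\<close> stands for the midpoint x_{k+1/2}. The recursion is imposed for
  \<open>k < K\<close> only, so later values are arbitrary.\<close>

locale trajectory =
  fixes f :: "real^'n \<Rightarrow> real^'m" and \<delta> :: real and K :: nat
    and x xh v :: "nat \<Rightarrow> real^'n"
  assumes smooth_f: "smooth f"
    and rank_jac: "\<And>y. rank (jac f y) = CARD('m)"
    and \<delta>_pos: "\<delta> > 0"
    and xh: "\<And>k. k < K \<Longrightarrow> xh k = x k + (\<delta> / 2) *\<^sub>R v k"
    and v_Suc: "\<And>k. k < K \<Longrightarrow> v (Suc k) = reflection f (xh k) *v v k"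
    and x_Suc: "\<And>k. k < K \<Longrightarrow> x (Suc k) = xh k + (\<delta> / 2) *\<^sub>R v (Suc k)"
begin

lemma norm_v: "k \<le> K \<Longrightarrow> norm (v k) = norm (v 0)"
proof (induction k)
  case (Suc k)
  then show ?case
    by (simp add: v_Suc norm_reflection rank_jac)
qed simp

lemma xh_Suc: "Suc k < K \<Longrightarrow> xh (Suc k) = xh k + \<delta> *\<^sub>R v (Suc k)"
  by (simp add: xh x_Suc vec_eq_iff)

text \<open>Both endpoints of a step are thereby seen from its midpoint, the base point of the
  expansions.\<close>

lemma x_eq: "k < K \<Longrightarrow> x k = xh k + (\<delta> / 2) *\<^sub>R (- v k)"
  by (simp add: xh)

text \<open>The first-order terms cancel because \<open>J v' = - J v\<close> for the reflected velocity \<open>v'\<close>.\<close>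

lemma f_step:
  assumes "k < K"
  shows "f (x (Suc k)) - f (x k) =
    taylor_remainder f (\<delta> / 2) (xh k) (v (Suc k)) - taylor_remainder f (\<delta> / 2) (xh k) (- v k)"
proof -
  have "jac f (xh k) *v v (Suc k) = - (jac f (xh k) *v v k)"
    using assms by (simp add: v_Suc jac_reflection rank_jac)
  then show ?thesis
    unfolding taylor_remainder_def x_eq[OF assms] x_Suc[OF assms] by (simp add: vec.neg)
qed

lemma norm_f_diff_le:
  fixes \<beta> \<gamma> :: real
  assumes "K \<ge> 1"
    and \<beta>: "\<And>y. bilinear_norm (second_deriv f y) \<le> \<beta>"
    and \<gamma>: "\<And>y z. bilinear_norm (\<lambda>u w. second_deriv f y u w - second_deriv f z u w)
      \<le> \<gamma> * norm (y - z)"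
  shows "norm (f (x K) - f (x 0))
    \<le> \<delta>\<^sup>2 / 12 * (norm (v 0))\<^sup>2 * (3 * \<beta> + \<gamma> * (real K - 1) * \<delta> * norm (v 0))"
proof -
  let ?a = "\<lambda>k. taylor_remainder f (\<delta> / 2) (xh k) (v (Suc k))"
  let ?b = "\<lambda>k. taylor_remainder f (\<delta> / 2) (xh k) (- v k)"
  let ?V = "norm (v 0)"
  obtain n where K: "K = Suc n"
    using \<open>K \<ge> 1\<close> by (cases K) auto
  \<comment> \<open>The telescoping sum is regrouped: \<open>?a i\<close> looks forward from
    midpoint i and \<open>?b (Suc i)\<close> backward from midpoint i + 1, both along the segment
    with velocity \<open>v (Suc i)\<close>. The first backward and the last forward half remain
    unpaired.\<close>
  have sum: "f (x (Suc k)) - f (x 0) = (\<Sum>i<k. ?a i - ?b (Suc i)) + ?a k - ?b 0" if "k < K" for k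
    using that
  proof (induction k)
    case (Suc k)
    have "f (x (Suc (Suc k))) - f (x 0) =
        (f (x (Suc (Suc k))) - f (x (Suc k))) + (f (x (Suc k)) - f (x 0))"
      by simp
    also have "\<dots> = ?a (Suc k) - ?b (Suc k) + ((\<Sum>i<k. ?a i - ?b (Suc i)) + ?a k - ?b 0)"
      using Suc by (simp only: f_step Suc_lessD)
    finally show ?case
      by simp
  qed (simp add: f_step)
  \<comment> \<open>With h = \<delta>/2 the point y + 2 h w is the next midpoint, and 2 h^3 / 3 =
    \<delta>^3 / 12.\<close>
  have diff: "norm (?a i - ?b (Suc i)) \<le> \<gamma> * \<delta> ^ 3 * ?V ^ 3 / 12" if "i < n" for i
    using norm_taylor_remainder_diff_le[OF smooth_f _ \<gamma>, of "\<delta> / 2" "xh i" "v (Suc i)"]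
      norm_v[of "Suc i"] that \<delta>_pos
    by (simp add: K xh_Suc power_divide mult_ac)
  \<comment> \<open>Here h^2 / 2 = \<delta>^2 / 8; the two ends together give the \<beta> term, as
    2/8 = 3/12.\<close>
  have ends: "norm (?a n) \<le> \<beta> * ?V\<^sup>2 * \<delta>\<^sup>2 / 8" "norm (?b 0) \<le> \<beta> * ?V\<^sup>2 * \<delta>\<^sup>2 / 8"
    using norm_taylor_remainder_le[OF smooth_f _ \<beta>, of "\<delta> / 2" "xh n" "v (Suc n)"]
      norm_taylor_remainder_le[OF smooth_f _ \<beta>, of "\<delta> / 2" "xh 0" "- v 0"]
      norm_v[of "Suc n"] \<delta>_pos
    by (simp_all add: K power_divide)
  have "norm (f (x K) - f (x 0)) \<le> norm (\<Sum>i<n. ?a i - ?b (Suc i)) + norm (?a n) + norm (?b 0)"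
    using norm_triangle_ineq4[of "(\<Sum>i<n. ?a i - ?b (Suc i)) + ?a n" "?b 0"]
      norm_triangle_ineq[of "\<Sum>i<n. ?a i - ?b (Suc i)" "?a n"]
    by (simp add: K sum)
  also have "norm (\<Sum>i<n. ?a i - ?b (Suc i)) \<le> real n * (\<gamma> * \<delta> ^ 3 * ?V ^ 3 / 12)"
    using sum_norm_bound[of "{..<n}" "\<lambda>i. ?a i - ?b (Suc i)", OF diff] by simp
  finally have "norm (f (x K) - f (x 0)) \<le>
      real n * (\<gamma> * \<delta> ^ 3 * ?V ^ 3 / 12) + \<beta> * ?V\<^sup>2 * \<delta>\<^sup>2 / 8 + \<beta> * ?V\<^sup>2 * \<delta>\<^sup>2 / 8"
    using ends by linarith
  also have "\<dots> = \<delta>\<^sup>2 / 12 * ?V\<^sup>2 * (3 * \<beta> + \<gamma> * (real K - 1) * \<delta> * ?V)"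
    by (simp add: K field_simps power2_eq_square power3_eq_cube)
  finally show ?thesis .
qed

text \<open>Both remainders in \<open>f_step\<close> depend only on the speed, which the reflection
  conserves, so they cancel.\<close>

lemma f_constant:
  assumes \<nu>: "\<And>y w. second_deriv f y w w = (norm w)\<^sup>2 *\<^sub>R \<nu>"
  shows "k \<le> K \<Longrightarrow> f (x k) = f (x 0)"
proof (induction k)
  case (Suc k)
  then have "f (x (Suc k)) - f (x k) = 0"
    using \<delta>_pos f_step[of k] norm_v[of k] norm_v[of "Suc k"]
    by (simp add: taylor_remainder_radial[OF smooth_f _ \<nu>])
  with Suc show ?case
    by simp
qed simp

end

section \<open>Assembly of the seven claims\<close>

theorem proposition1:
  fixes f :: "real^'n \<Rightarrow> real^'m" and \<delta> :: real
  assumes n_ge_2: "CARD('n) \<ge> 2"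
    and m_bounds: "0 < CARD('m)" "CARD('m) < CARD('n)"
    and smooth_f: "smooth f"
    and full_rank: "\<And>x. rank (jac f x) = CARD('m)"
    and \<delta>_pos: "\<delta> > 0"
  shows "volume_preserving (Psi f \<delta>) \<and>
    (\<forall>x v x' v'. Psi f \<delta> (x, v) = (x', v') \<longleftrightarrow> Psi f \<delta> (x', - v') = (x, - v)) \<and>
    (\<forall>K\<ge>1. \<forall>x xh v :: nat \<Rightarrow> real^'n.
       (\<forall>k<K. xh k = x k + (\<delta> / 2) *\<^sub>R v k \<and>
              v (Suc k) = reflection f (xh k) *v v k \<and>
              x (Suc k) = xh k + (\<delta> / 2) *\<^sub>R v (Suc k)) \<longrightarrow>
       (\<forall>k<K. tangent_proj f (xh k) *v v (Suc k) = tangent_proj f (xh k) *v v k \<and>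
              normal_proj f (xh k) *v v (Suc k) = - (normal_proj f (xh k) *v v k) \<and>
              v k + v (Suc k) = 2 *\<^sub>R (tangent_proj f (xh k) *v v k)) \<and>
       (\<forall>k\<le>K. norm (v k) = norm (v 0)) \<and>
       (\<forall>k<K. norm (xh k - x k) = (\<delta> / 2) * norm (v 0) \<and>
              norm (x (Suc k) - xh k) = (\<delta> / 2) * norm (v 0)) \<and>
       (\<forall>k. Suc k < K \<longrightarrow> norm (xh (Suc k) - xh k) = \<delta> * norm (v 0)) \<and>
       (\<forall>\<beta> \<gamma> :: real.
          (\<forall>y. bilinear_norm (second_deriv f y) \<le> \<beta>) \<and>
          (\<forall>y z. bilinear_norm (\<lambda>u w. second_deriv f y u w - second_deriv f z u w)
                    \<le> \<gamma> * norm (y - z)) \<longrightarrow>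
          norm (f (x K) - f (x 0))
            \<le> \<delta>^2 / 12 * (norm (v 0))^2 * (3 * \<beta> + \<gamma> * (real K - 1) * \<delta> * norm (v 0))) \<and>
       (\<forall>\<nu> :: real^'m. (\<forall>y w. second_deriv f y w w = (norm w)^2 *\<^sub>R \<nu>) \<longrightarrow>
          (\<forall>k\<le>K. f (x k) = f (x 0))))"
proof (intro conjI, goal_cases)
  case 1
  show ?case
    by (rule volume_preserving_Psi[OF smooth_f full_rank])
next
  case 2
  \<comment> \<open>The converse is the same implication applied at (x', -v'), since double negation
    restores the velocities.\<close>
  show ?case
    using Psi_reversible[OF full_rank, of \<delta>] by (metis minus_minus)
next
  case 3
  show ?case
  proof (intro allI impI, goal_cases)
    case (1 K x xh v)
    interpret trajectory f \<delta> K x xh v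
      using 1 smooth_f full_rank \<delta>_pos by unfold_locales auto
    have "norm (xh k - x k) = (\<delta> / 2) * norm (v 0)"
      "norm (x (Suc k) - xh k) = (\<delta> / 2) * norm (v 0)" if "k < K" for k
      using that \<delta>_pos norm_v[of k] norm_v[of "Suc k"] by (simp_all add: xh x_Suc)
    moreover have "norm (xh (Suc k) - xh k) = \<delta> * norm (v 0)" if "Suc k < K" for k
      using that \<delta>_pos norm_v[of "Suc k"] by (simp add: xh_Suc)
    moreover have "tangent_proj f (xh k) *v v (Suc k) = tangent_proj f (xh k) *v v k"
      "normal_proj f (xh k) *v v (Suc k) = - (normal_proj f (xh k) *v v k)"
      "v k + v (Suc k) = 2 *\<^sub>R (tangent_proj f (xh k) *v v k)" if "k < K" for k
      using that
      by (simp_all only: v_Suc tangent_proj_reflection normal_proj_reflection add_reflection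
          rank_jac)
    ultimately show ?case
      using norm_v norm_f_diff_le[OF \<open>1 \<le> K\<close>] f_constant by (intro conjI allI impI) blast+
  qed
qed

end
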